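(* Let $n\ge 2$, let $0\le \alpha_1<\alpha_2<\dots<\alpha_n$ be integers and $x_1,\dots,x_n$ positive integers, and put $p_k=\sum_{i=1}^k x_i$, $q_k=\sum_{i=1}^k \alpha_i x_i$. Suppose that the non-decreasing sequence consisting of $\alpha_1$ repeated $x_1$ times, $\alpha_2$ repeated $x_2$ times, ..., $\alpha_n$ repeated $x_n$ times is the score sequence (sequence of out-degrees) of some tournament. Then for every $k\in\{1,\dots,n\}$, $$p_k\le 2\alpha_k+1\qquad\text{and}\qquad q_k\le \alpha_k(2\alpha_k+1).$$
   Context: A tournament is a directed graph obtained by orienting each edge of a complete graph; its score sequence is the sequence of out-degrees of its vertices. *)

theory Defs
  imports "Graph_Theory.Digraph" "HOL-Library.Multiset"
begin

text \<open>
  The locale \<^locale>\<open>digraph\<close> is finite, loop-free and without parallel arcs; the inequality of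
  truth values below says that each pair of distinct vertices is joined in exactly one direction.
\<close>
locale tournament = digraph +
  assumes oriented:
    "\<lbrakk>u \<in> verts G; v \<in> verts G; u \<noteq> v\<rbrakk> \<Longrightarrow> (u \<rightarrow>\<^bsub>G\<^esub> v) \<noteq> (v \<rightarrow>\<^bsub>G\<^esub> u)"

text \<open>Scores are listed in non-decreasing order, one entry per vertex.\<close>
definition score_sequence :: "('a, 'b) pre_digraph \<Rightarrow> nat list" where
  "score_sequence G = sorted_list_of_multiset (image_mset (out_degree G) (mset_set (verts G)))"

end

theory Submission
  imports Defs
begin

text \<open>
  If \<open>W\<close> is the set of the \<open>p\<^sub>k\<close> vertices of score at most \<open>\<alpha>\<^sub>k\<close>, then the arcs inside \<open>W\<close> show that
  the scores of \<open>W\<close> sum to at least \<open>p\<^sub>k (p\<^sub>k - 1) / 2\<close>, whereas that sum is at most \<open>p\<^sub>k \<alpha>\<^sub>k\<close>.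
\<close>

text \<open>Each counted \<open>w\<close> is the head of an arc leaving \<open>v\<close>, and
  distinct heads need distinct arcs. Arcs leaving \<open>W\<close> and parallel arcs only enlarge
  the right-hand side.\<close>

lemma (in fin_digraph) card_dominated_le_out_degree:
  "card {w \<in> W. v \<rightarrow> w} \<le> out_degree G v"
proof -
  have "{w \<in> W. v \<rightarrow> w} \<subseteq> head G ` out_arcs G v"
    by (auto simp: arcs_ends_conv out_arcs_def)
  then have "card {w \<in> W. v \<rightarrow> w} \<le> card (head G ` out_arcs G v)"
    by (intro card_mono) auto
  also have "\<dots> \<le> out_degree G v"
    unfolding out_degree_def by (intro card_image_le) auto
  finally show ?thesis .
qed

text \<open>Double counting: adding in- and out-degrees within \<open>W\<close> gives
  \<open>card W - 1\<close> at each vertex and counts every arc inside \<open>W\<close> twice. The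
  factor 2 avoids a division.\<close>

lemma (in tournament) sum_out_degree_ge:
  assumes "W \<subseteq> verts G"
  shows "card W * (card W - 1) \<le> 2 * (\<Sum>v\<in>W. out_degree G v)"
proof -
  have fin: "finite W"
    using assms finite_verts finite_subset by blast
  have split: "card {w \<in> W. v \<rightarrow> w} + card {w \<in> W. w \<rightarrow> v} = card W - 1" if "v \<in> W" for v
  proof -
    have irrefl: "\<not> v \<rightarrow> v"
      using adj_not_same by blast
    have "{w \<in> W. v \<rightarrow> w} \<union> {w \<in> W. w \<rightarrow> v} = W - {v}"
      using oriented assms that irrefl by blast
    moreover have "{w \<in> W. v \<rightarrow> w} \<inter> {w \<in> W. w \<rightarrow> v} = {}"
      using oriented assms that irrefl by blast
    ultimately show ?thesis
      using fin that
        card_Un_disjoint[of "{w \<in> W. v \<rightarrow> w}" "{w \<in> W. w \<rightarrow> v}"]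
      by simp
  qed
  \<comment> \<open>Both sides count the arcs inside \<open>W\<close>, once by head and once by
    tail.\<close>
  have swap: "(\<Sum>v\<in>W. card {w \<in> W. w \<rightarrow> v}) = (\<Sum>v\<in>W. card {w \<in> W. v \<rightarrow> w})"
    using sum_multicount_gen[OF fin fin, of "\<lambda>v w. v \<rightarrow> w" "\<lambda>v. card {w \<in> W. w \<rightarrow> v}"]
    by simp
  have "card W * (card W - 1) = (\<Sum>v\<in>W. card {w \<in> W. v \<rightarrow> w} + card {w \<in> W. w \<rightarrow> v})"
    using split by simp
  also have "\<dots> = 2 * (\<Sum>v\<in>W. card {w \<in> W. v \<rightarrow> w})"
    by (simp add: sum.distrib swap)
  also have "\<dots> \<le> 2 * (\<Sum>v\<in>W. out_degree G v)"
    by (intro mult_left_mono sum_mono card_dominated_le_out_degree) simp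
  finally show ?thesis .
qed

lemma (in tournament) card_out_degree_le:
  "card {v \<in> verts G. out_degree G v \<le> a} \<le> 2 * a + 1"
proof -
  let ?W = "{v \<in> verts G. out_degree G v \<le> a}"
  have "card ?W * (card ?W - 1) \<le> 2 * (\<Sum>v\<in>?W. out_degree G v)"
    by (intro sum_out_degree_ge) auto
  also have "(\<Sum>v\<in>?W. out_degree G v) \<le> card ?W * a"
    using sum_bounded_above[of ?W "out_degree G" a] by simp
  finally have "card ?W * (card ?W - 1) \<le> card ?W * (2 * a)"
    by simp
  \<comment> \<open>Cancelling \<open>card ?W\<close> requires it to be nonzero; if it is zero, the
    bound is trivial. Truncated subtraction does no harm in either case.\<close>
  then have "card ?W = 0 \<or> card ?W - 1 \<le> 2 * a"
    unfolding mult_le_cancel1 by blast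
  then show ?thesis
    by linarith
qed

text \<open>The length of a filtered list depends only on its multiset, so the sorting is
  irrelevant.\<close>

lemma length_filter_score_sequence:
  assumes "finite (verts G)"
  shows "length (filter P (score_sequence G)) = card {v \<in> verts G. P (out_degree G v)}"
proof -
  have "length (filter P (score_sequence G)) = size (filter_mset P (mset (score_sequence G)))"
    by (metis mset_filter size_mset)
  also have "\<dots> = card {v \<in> verts G. P (out_degree G v)}"
    using assms by (simp add: score_sequence_def filter_mset_image_mset filter_mset_mset_set)
  finally show ?thesis .
qed

theorem theorem3p1:
  fixes n :: nat and \<alpha> x :: "nat \<Rightarrow> nat" and T :: "('a, 'b) pre_digraph"
  assumes "n \<ge> 2"
    and "strict_mono_on {1..n} \<alpha>"
    and "\<forall>i\<in>{1..n}. x i > 0"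
    and "tournament T"
    and "score_sequence T = concat (map (\<lambda>i. replicate (x i) (\<alpha> i)) [1..<Suc n])"
  shows "\<forall>k\<in>{1..n}.
           (\<Sum>i=1..k. x i) \<le> 2 * \<alpha> k + 1 \<and>
           (\<Sum>i=1..k. \<alpha> i * x i) \<le> \<alpha> k * (2 * \<alpha> k + 1)"
proof
  fix k assume k: "k \<in> {1..n}"
  interpret tournament T by fact
  have le_iff: "\<alpha> i \<le> \<alpha> k \<longleftrightarrow> i \<le> k" if "i \<in> {1..n}" for i
    using strict_mono_on_less_eq[OF assms(2) that k] .
  have "card {v \<in> verts T. out_degree T v \<le> \<alpha> k}
      = length (filter (\<lambda>s. s \<le> \<alpha> k) (score_sequence T))"
    by (simp add: length_filter_score_sequence)
  \<comment> \<open>The entries of block \<open>i\<close> all equal \<open>\<alpha> i\<close>, so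
    the filter keeps the block whole or drops it. By \<open>le_iff\<close> the kept blocks are the
    first \<open>k\<close>, so the count is the partial sum of \<open>x\<close>.\<close>
  also have "\<dots> = (\<Sum>i\<leftarrow>[1..<Suc n]. if \<alpha> i \<le> \<alpha> k then x i else 0)"
    unfolding assms(5) filter_concat length_concat map_map
    by (intro arg_cong[where f = sum_list] map_cong) auto
  also have "\<dots> = (\<Sum>i\<in>{1..n}. if \<alpha> i \<le> \<alpha> k then x i else 0)"
    by (subst sum_list_distinct_conv_sum_set) (auto intro: sum.cong)
  also have "\<dots> = (\<Sum>i\<in>{i \<in> {1..n}. \<alpha> i \<le> \<alpha> k}. x i)"
    by (simp add: sum.If_cases Int_def)
  also have "{i \<in> {1..n}. \<alpha> i \<le> \<alpha> k} = {1..k}"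
    using k le_iff by auto
  finally have p: "(\<Sum>i=1..k. x i) \<le> 2 * \<alpha> k + 1"
    using card_out_degree_le[of "\<alpha> k"] by simp
  \<comment> \<open>Raising every score to the largest one, \<open>\<alpha> k\<close>, reduces the
    second bound to the first.\<close>
  have "(\<Sum>i=1..k. \<alpha> i * x i) \<le> (\<Sum>i=1..k. \<alpha> k * x i)"
    using k le_iff by (intro sum_mono mult_right_mono) auto
  also have "\<dots> \<le> \<alpha> k * (2 * \<alpha> k + 1)"
    unfolding sum_distrib_left[symmetric] using p by (rule mult_le_mono2)
  finally show "(\<Sum>i=1..k. x i) \<le> 2 * \<alpha> k + 1 \<and>
      (\<Sum>i=1..k. \<alpha> i * x i) \<le> \<alpha> k * (2 * \<alpha> k + 1)"
    using p by blast
qed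

end
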